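(* Let $\beta>0$, let $X,Y$ be $\beta$-homogeneous $F$-spaces and let $\varphi:X^{2}\to[0,\infty)$ be a function such that there exists an $L<1$ with $$\varphi(x,y)\le 2^{\beta}L\,\varphi\left(\frac{x}{2},\frac{y}{2}\right)\le 4^{\beta}L\,\varphi\left(\frac{x}{2},\frac{y}{2}\right)$$ for all $x,y\in X$. Let $f:X^{2}\to Y$ be a mapping satisfying $$\|f(x+y,z+w)+f(x-y,z-w)-2f(x,z)-2f(x,w)\|\le \varphi(x,y)\,\varphi(z,w)$$ for all $x,y,z,w\in X$ and $f(x,0)=f(0,z)=0$ for all $x,z\in X$. Then there exists a unique additive-quadratic mapping $F:X^{2}\to Y$ such that $$\|f(x,z)-F(x,z)\|\le\min\left\{\frac{1}{2^{\beta}(1-L)}\varphi(x,x)\varphi(z,0),\ \frac{1}{4^{\beta}(1-L)}\varphi(x,0)\varphi(z,z)\right\}$$ for all $x,z\in X$.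
   Context: An $F$-norm on a (complex) linear space $X$ is a function $\|\cdot\|:X\to[0,\infty)$ such that: (1) $\|x\|=0$ iff $x=0$; (2) $\|\lambda x\|=\|x\|$ whenever $|\lambda|=1$; (3) $\|x+y\|\le\|x\|+\|y\|$; (4) $\|\lambda_n x\|\to0$ whenever $\lambda_n\to0$; (5) $\|\lambda x_n\|\to0$ whenever $x_n\to0$; (6) $\|\lambda_n x_n\|\to0$ whenever $\lambda_n\to0$ and $x_n\to0$. An $F$-space is a linear space with an $F$-norm that is complete for the metric $\|x-y\|$. It is $\beta$-homogeneous ($\beta>0$) if $\|tx\|=|t|^{\beta}\|x\|$ for all $x\in X$ and all $t\in\mathbb{C}$. The same $\beta$ is used for $X$ and $Y$, and both $F$-norms are written $\|\cdot\|$. A mapping $F:X^2\to Y$ is called additive-quadratic if $F(x+y,z+w)+F(x-y,z-w)-2F(x,z)-2F(x,w)=0$ for all $x,y,z,w\in X$. *)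

theory Defs
  imports "HOL-Analysis.Analysis"
begin

(* HOL-Analysis has no type class of complex vector spaces, so a complex linear space is an
   instance of the library locale vector_space over the field complex; the underlying set is the
   whole type 'a. Convergence of vectors to 0 is convergence with respect to the F-norm. *)

locale F_normed_space = vector_space scale
  for scale :: "complex \<Rightarrow> 'a::ab_group_add \<Rightarrow> 'a" +
  fixes nrm :: "'a \<Rightarrow> real"
  assumes nrm_nonneg: "nrm x \<ge> 0"
    and nrm_eq_0_iff: "nrm x = 0 \<longleftrightarrow> x = 0"
    and nrm_scale_unit: "cmod c = 1 \<Longrightarrow> nrm (scale c x) = nrm x"
    and nrm_triangle: "nrm (x + y) \<le> nrm x + nrm y"
    and scalar_tendsto_0: "a \<longlonglongrightarrow> 0 \<Longrightarrow> (\<lambda>n::nat. nrm (scale (a n) x)) \<longlonglongrightarrow> 0"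
    and vector_tendsto_0: "(\<lambda>n. nrm (u n)) \<longlonglongrightarrow> 0 \<Longrightarrow> (\<lambda>n::nat. nrm (scale d (u n))) \<longlonglongrightarrow> 0"
    and scalar_vector_tendsto_0:
      "a \<longlonglongrightarrow> 0 \<Longrightarrow> (\<lambda>n. nrm (u n)) \<longlonglongrightarrow> 0 \<Longrightarrow> (\<lambda>n::nat. nrm (scale (a n) (u n))) \<longlonglongrightarrow> 0"
begin

lemma nrm_minus: "nrm (- x) = nrm x"
  using nrm_scale_unit[of "-1" x] by simp

sublocale metric: Metric_space UNIV "\<lambda>x y. nrm (x - y)"
proof
  fix x y z :: 'a
  show "0 \<le> nrm (x - y)" by (rule nrm_nonneg)
  show "nrm (x - y) = nrm (y - x)" using nrm_minus[of "x - y"] by simp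
  show "nrm (x - y) = 0 \<longleftrightarrow> x = y" by (simp add: nrm_eq_0_iff)
  show "nrm (x - z) \<le> nrm (x - y) + nrm (y - z)"
    using nrm_triangle[of "x - y" "y - z"] by simp
qed

end

locale F_space = F_normed_space +
  assumes complete: "metric.mcomplete"

locale homogeneous_F_space = F_space scale nrm
  for scale :: "complex \<Rightarrow> 'a::ab_group_add \<Rightarrow> 'a" and nrm :: "'a \<Rightarrow> real" +
  fixes \<beta> :: real
  assumes beta_pos: "\<beta> > 0"
    and homogeneous: "nrm (scale t x) = cmod t powr \<beta> * nrm x"

definition additive_quadratic ::
  "(complex \<Rightarrow> 'b \<Rightarrow> 'b) \<Rightarrow> ('a::ab_group_add \<Rightarrow> 'a \<Rightarrow> 'b::ab_group_add) \<Rightarrow> bool" where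
  "additive_quadratic scaleY F \<longleftrightarrow>
     (\<forall>x y z w. F (x + y) (z + w) + F (x - y) (z - w) - scaleY 2 (F x z) - scaleY 2 (F x w) = 0)"

end

theory Submission imports Defs begin

text \<open>
  Setting \<open>y = x\<close>, \<open>w = 0\<close> shows that \<open>f (2x) z\<close> is close to \<open>2 f x z\<close>, and the contraction
  property of \<open>\<phi>\<close> makes \<open>2\<^sup>-\<^sup>n f (2\<^sup>n x) z\<close> a Cauchy sequence whose limit \<open>F\<close> is
  additive-quadratic and satisfies the first of the two bounds. Setting \<open>y = 0\<close>, \<open>w = z\<close> shows
  that \<open>4\<^sup>-\<^sup>n f x (2\<^sup>n z)\<close> stays within the second bound of \<open>f x z\<close>. The first bound alone
  forces this sequence to converge to \<open>F x z\<close> for every admissible \<open>F\<close>, which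
  gives the second bound and uniqueness at once.
\<close>

section \<open>Limits, geometric convergence and homogeneity for F-norms\<close>

context F_normed_space
begin

lemma nrm_diff_commute: "nrm (x - y) = nrm (y - x)"
  using nrm_minus[of "x - y"] by simp

lemma nrm_limit_unique:
  assumes "(\<lambda>n::nat. nrm (u n - a)) \<longlonglongrightarrow> 0" "(\<lambda>n. nrm (u n - b)) \<longlonglongrightarrow> 0"
  shows "a = b"
proof -
  have "nrm (a - b) \<le> nrm (u n - a) + nrm (u n - b)" for n
    using nrm_triangle[of "a - u n" "u n - b"] nrm_diff_commute[of a "u n"] by simp
  moreover have "(\<lambda>n. nrm (u n - a) + nrm (u n - b)) \<longlonglongrightarrow> 0"
    using tendsto_add[OF assms] by simp
  ultimately have "nrm (a - b) \<le> 0"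
    by (intro LIMSEQ_le_const[where X = "\<lambda>n. nrm (u n - a) + nrm (u n - b)"]) auto
  then have "nrm (a - b) = 0" using nrm_nonneg[of "a - b"] by linarith
  then show ?thesis by (simp add: nrm_eq_0_iff)
qed

lemma nrm_limit_add:
  assumes "(\<lambda>n::nat. nrm (u n - a)) \<longlonglongrightarrow> 0" "(\<lambda>n. nrm (v n - b)) \<longlonglongrightarrow> 0"
  shows "(\<lambda>n. nrm ((u n + v n) - (a + b))) \<longlonglongrightarrow> 0"
proof (rule tendsto_sandwich[OF _ _ tendsto_const tendsto_add_zero[OF assms]])
  show "\<forall>\<^sub>F n in sequentially. nrm ((u n + v n) - (a + b)) \<le> nrm (u n - a) + nrm (v n - b)"
    using nrm_triangle[of "u n - a" "v n - b" for n] by (simp add: algebra_simps)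
qed (simp add: nrm_nonneg)

lemma nrm_limit_scale:
  assumes "(\<lambda>n::nat. nrm (u n - a)) \<longlonglongrightarrow> 0"
  shows "(\<lambda>n. nrm (scale c (u n) - scale c a)) \<longlonglongrightarrow> 0"
  using vector_tendsto_0[OF assms, of c] by (simp add: scale_right_diff_distrib)

lemma nrm_limit_diff:
  assumes "(\<lambda>n::nat. nrm (u n - a)) \<longlonglongrightarrow> 0" "(\<lambda>n. nrm (v n - b)) \<longlonglongrightarrow> 0"
  shows "(\<lambda>n. nrm ((u n - v n) - (a - b))) \<longlonglongrightarrow> 0"
  using nrm_limit_add[OF assms(1) nrm_limit_scale[OF assms(2), of "-1"]] by simp

lemma nrm_limit_le:
  assumes "(\<lambda>n::nat. nrm (u n - a)) \<longlonglongrightarrow> 0" and "\<And>n. nrm (x - u n) \<le> C"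
  shows "nrm (x - a) \<le> C"
proof -
  have "nrm (x - a) \<le> C + nrm (u n - a)" for n
    using nrm_triangle[of "x - u n" "u n - a"] assms(2)[of n] by simp
  moreover have "(\<lambda>n. C + nrm (u n - a)) \<longlonglongrightarrow> C"
    using tendsto_add[OF tendsto_const assms(1), of C] by simp
  ultimately show ?thesis
    by (intro LIMSEQ_le_const[where X = "\<lambda>n. C + nrm (u n - a)"]) auto
qed

text \<open>Telescoping against a geometric series. The case \<open>m = 0\<close> yields the
  constants in the stability bounds, general \<open>m\<close> the Cauchy property.\<close>

lemma nrm_diff_geometric_bound:
  assumes L: "0 \<le> L" "L < 1"
    and step: "\<And>n. nrm (u (Suc n) - u n) \<le> c * L ^ n"
    and "m \<le> n"
  shows "nrm (u n - u m) \<le> c / (1 - L) * L ^ m"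
proof -
  \<comment> \<open>At index 0 the step bound is \<open>c\<close> itself, since
    \<open>L ^ 0 = 1\<close>.\<close>
  have c: "0 \<le> c" using order_trans[OF nrm_nonneg step[of 0]] by simp
  \<comment> \<open>The exact sum of \<open>c * L ^ k\<close> over \<open>m \<le> k < n\<close> is
    carried through the induction; the final bound is too weak to absorb another increment.\<close>
  have "nrm (u n - u m) \<le> c * (L ^ m - L ^ n) / (1 - L)"
    using \<open>m \<le> n\<close>
  proof (induction n rule: dec_induct)
    case base
    then show ?case using nrm_eq_0_iff[of 0] by simp
  next
    case (step n)
    have "nrm (u (Suc n) - u m) \<le> nrm (u (Suc n) - u n) + nrm (u n - u m)"
      using nrm_triangle[of "u (Suc n) - u n" "u n - u m"] by simp
    also have "\<dots> \<le> c * L ^ n + c * (L ^ m - L ^ n) / (1 - L)"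
      using assms(3)[of n] step.IH by simp
    also have "\<dots> = c * (L ^ m - L ^ Suc n) / (1 - L)"
      using L by (simp add: field_simps)
    finally show ?case .
  qed
  also have "\<dots> \<le> c / (1 - L) * L ^ m"
    using L c by (simp add: divide_right_mono mult_left_mono)
  finally show ?thesis .
qed

end

lemma (in F_space) geometric_limit:
  assumes L: "0 \<le> L" "L < 1"
    and step: "\<And>n. nrm (u (Suc n) - u n) \<le> c * L ^ n"
  shows "\<exists>l. (\<lambda>n. nrm (u n - l)) \<longlonglongrightarrow> 0"
proof -
  have lim: "(\<lambda>m. c / (1 - L) * L ^ m) \<longlonglongrightarrow> 0"
    using L by (intro tendsto_mult_right_zero LIMSEQ_realpow_zero) auto
  have "metric.MCauchy u"
    unfolding metric.MCauchy_def
  proof (intro conjI allI impI)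
    fix e :: real assume "e > 0"
    then obtain N where N: "\<And>m. m \<ge> N \<Longrightarrow> c / (1 - L) * L ^ m < e"
      using order_tendstoD(2)[OF lim] by (auto simp: eventually_sequentially)
    have "nrm (u n - u m) < e" if "N \<le> m" "N \<le> n" for m n
    proof (cases "m \<le> n")
      case True
      then show ?thesis
        using nrm_diff_geometric_bound[OF L step True] N[OF that(1)] by linarith
    next
      case False
      then have "n \<le> m" by simp
      then show ?thesis
        using nrm_diff_geometric_bound[OF L step \<open>n \<le> m\<close>] N[OF that(2)]
          nrm_diff_commute[of "u n" "u m"] by linarith
    qed
    then show "\<exists>N. \<forall>n n'. N \<le> n \<longrightarrow> N \<le> n' \<longrightarrow> nrm (u n - u n') < e" by blast
  qed simp
  then obtain l where l: "limitin metric.mtopology u l sequentially"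
    using complete by (auto simp: metric.mcomplete_def)
  have "(\<lambda>n. nrm (u n - l)) \<longlonglongrightarrow> 0"
  proof (rule LIMSEQ_I)
    fix e :: real assume "e > 0"
    with l show "\<exists>N. \<forall>n\<ge>N. norm (nrm (u n - l) - 0) < e"
      by (auto simp: metric.limit_metric_sequentially nrm_nonneg)
  qed
  then show ?thesis ..
qed

lemma (in homogeneous_F_space) nrm_scale_power:
  "nrm (scale (c ^ n) x) = (cmod c powr \<beta>) ^ n * nrm x"
proof (induction n)
  case (Suc n)
  have "nrm (scale (c ^ Suc n) x) = cmod c powr \<beta> * nrm (scale (c ^ n) x)"
    using homogeneous[of c "scale (c ^ n) x"] by simp
  then show ?case unfolding Suc.IH by simp
qed simp

section \<open>Exact identities for additive-quadratic mappings\<close>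

lemma additive_quadratic_zero:
  assumes "vector_space scaleY" "additive_quadratic scaleY F"
  shows "F x 0 = 0"
proof -
  interpret vector_space scaleY by fact
  have "F (x + 0) (0 + 0) + F (x - 0) (0 - 0) - scaleY 2 (F x 0) - scaleY 2 (F x 0) = 0"
    using assms(2) unfolding additive_quadratic_def by blast
  moreover have "v + v = scaleY 2 v" for v
    using scale_left_distrib[of 1 1 v] by simp
  ultimately show ?thesis by simp
qed

text \<open>Taking \<open>y = 0\<close> and \<open>w = z\<close> leaves the term
  \<open>F x (z - z)\<close>, which vanishes. This is the quadratic behaviour in the second
  variable.\<close>

lemma additive_quadratic_double:
  assumes "vector_space scaleY" "additive_quadratic scaleY F"
  shows "F x (z + z) = scaleY 4 (F x z)"
proof -
  interpret vector_space scaleY by fact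
  have "F (x + 0) (z + z) + F (x - 0) (z - z) - scaleY 2 (F x z) - scaleY 2 (F x z) = 0"
    using assms(2) unfolding additive_quadratic_def by blast
  moreover have "scaleY 4 v = scaleY 2 v + scaleY 2 v" for v
    using scale_left_distrib[of 2 2 v] by simp
  ultimately show ?thesis
    using additive_quadratic_zero[OF assms, of x] by (simp add: algebra_simps)
qed

section \<open>The approximate equation for nonnegative \<open>L\<close>\<close>

locale approx_additive_quadratic =
  X: vector_space scaleX + Y: homogeneous_F_space scaleY normY \<beta>
  for scaleX :: "complex \<Rightarrow> 'a::ab_group_add \<Rightarrow> 'a"
    and scaleY :: "complex \<Rightarrow> 'b::ab_group_add \<Rightarrow> 'b" and normY :: "'b \<Rightarrow> real"
    and \<beta> :: real +
  fixes L :: real and \<phi> :: "'a \<Rightarrow> 'a \<Rightarrow> real" and f :: "'a \<Rightarrow> 'a \<Rightarrow> 'b"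
  assumes phi_nonneg: "\<phi> x y \<ge> 0"
    and L_nonneg: "0 \<le> L" and L_less_1: "L < 1"
    and phi_half: "\<phi> x y \<le> 2 powr \<beta> * L * \<phi> (scaleX (1/2) x) (scaleX (1/2) y)"
    and approx: "normY (f (x + y) (z + w) + f (x - y) (z - w)
                   - scaleY 2 (f x z) - scaleY 2 (f x w)) \<le> \<phi> x y * \<phi> z w"
    and f_zero_right: "f x 0 = 0"
    and f_zero_left: "f 0 z = 0"
begin

abbreviation dbl :: "nat \<Rightarrow> 'a \<Rightarrow> 'a" where
  "dbl n \<equiv> scaleX (2 ^ n)"

lemma dbl_Suc: "dbl (Suc n) x = dbl n x + dbl n x"
  using X.scale_left_distrib[of "2 ^ n" "2 ^ n" x] by simp

text \<open>Read at doubled arguments, the halving inequality says that each doubling costs at most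
  a factor \<open>2 powr \<beta> * L\<close>.\<close>

lemma phi_dbl: "\<phi> (dbl n x) (dbl n y) \<le> (2 powr \<beta> * L) ^ n * \<phi> x y"
proof (induction n)
  case 0
  show ?case by simp
next
  case (Suc n)
  have "\<phi> (dbl (Suc n) x) (dbl (Suc n) y) \<le> 2 powr \<beta> * L * \<phi> (dbl n x) (dbl n y)"
    using phi_half[of "dbl (Suc n) x" "dbl (Suc n) y"] by simp
  also have "\<dots> \<le> 2 powr \<beta> * L * ((2 powr \<beta> * L) ^ n * \<phi> x y)"
    using Suc.IH L_nonneg by (intro mult_left_mono) auto
  finally show ?case by (simp add: mult_ac)
qed

lemma four_powr: "4 powr \<beta> = 2 powr \<beta> * (2 powr \<beta>)"
  using powr_mult[of 2 2 \<beta>] by simp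

lemma two_powr_gt_1: "2 powr \<beta> > 1"
  using Y.beta_pos by simp

lemma normY_half_power: "normY (scaleY ((1/2) ^ n) v) = normY v / (2 powr \<beta>) ^ n"
  unfolding Y.nrm_scale_power by (simp add: powr_divide norm_divide power_divide)

lemma normY_quarter_power: "normY (scaleY ((1/4) ^ n) v) = normY v / (4 powr \<beta>) ^ n"
  unfolding Y.nrm_scale_power by (simp add: powr_divide norm_divide power_divide)

section \<open>Rescaled iterates in each variable\<close>

lemma approx_double_left: "normY (f (x + x) z - scaleY 2 (f x z)) \<le> \<phi> x x * \<phi> z 0"
  using approx[of x x z 0] by (simp add: f_zero_left f_zero_right)

lemma approx_double_right: "normY (f x (z + z) - scaleY 4 (f x z)) \<le> \<phi> x 0 * \<phi> z z"
proof -
  have "scaleY 4 v = scaleY 2 v + scaleY 2 v" for v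
    using Y.scale_left_distrib[of 2 2 v] by simp
  then show ?thesis
    using approx[of x 0 z z] by (simp add: f_zero_right diff_diff_eq)
qed

text \<open>The growth \<open>(2 powr \<beta> * L) ^ n\<close> of \<open>\<phi>\<close> meets the
  divisor \<open>(2 powr \<beta>) ^ Suc n\<close> from homogeneity; what remains is
  \<open>L ^ n / 2 powr \<beta>\<close>.\<close>

lemma left_iterates_step:
  "normY (scaleY ((1/2) ^ Suc n) (f (dbl (Suc n) x) z) - scaleY ((1/2) ^ n) (f (dbl n x) z))
     \<le> \<phi> x x * \<phi> z 0 / 2 powr \<beta> * L ^ n"
proof -
  let ?u = "dbl n x"
  \<comment> \<open>Both iterates get the common factor \<open>(1/2) ^ Suc n\<close>, so that their
    difference is a rescaled doubling defect of \<open>f\<close>.\<close>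
  have "scaleY ((1/2) ^ n) v = scaleY ((1/2) ^ Suc n) (scaleY 2 v)" for v
    by simp
  then have "normY (scaleY ((1/2) ^ Suc n) (f (dbl (Suc n) x) z) - scaleY ((1/2) ^ n) (f ?u z))
      = normY (scaleY ((1/2) ^ Suc n) (f (?u + ?u) z - scaleY 2 (f ?u z)))"
    by (simp only: dbl_Suc Y.scale_right_diff_distrib)
  also have "\<dots> \<le> \<phi> ?u ?u * \<phi> z 0 / (2 powr \<beta>) ^ Suc n"
    unfolding normY_half_power by (intro divide_right_mono approx_double_left) simp
  also have "\<dots> \<le> ((2 powr \<beta> * L) ^ n * \<phi> x x) * \<phi> z 0 / (2 powr \<beta>) ^ Suc n"
    by (intro divide_right_mono mult_right_mono phi_dbl phi_nonneg) simp
  also have "\<dots> = \<phi> x x * \<phi> z 0 / 2 powr \<beta> * L ^ n"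
    by (simp add: power_mult_distrib field_simps)
  finally show ?thesis .
qed

lemma right_iterates_step:
  "normY (scaleY ((1/4) ^ Suc n) (f x (dbl (Suc n) z)) - scaleY ((1/4) ^ n) (f x (dbl n z)))
     \<le> \<phi> x 0 * \<phi> z z / 4 powr \<beta> * L ^ n"
proof -
  let ?u = "dbl n z"
  have "scaleY ((1/4) ^ n) v = scaleY ((1/4) ^ Suc n) (scaleY 4 v)" for v
    by simp
  then have "normY (scaleY ((1/4) ^ Suc n) (f x (dbl (Suc n) z)) - scaleY ((1/4) ^ n) (f x ?u))
      = normY (scaleY ((1/4) ^ Suc n) (f x (?u + ?u) - scaleY 4 (f x ?u)))"
    by (simp only: dbl_Suc Y.scale_right_diff_distrib)
  also have "\<dots> \<le> \<phi> x 0 * \<phi> ?u ?u / (4 powr \<beta>) ^ Suc n"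
    unfolding normY_quarter_power by (intro divide_right_mono approx_double_right) simp
  also have "\<dots> \<le> \<phi> x 0 * ((2 powr \<beta> * L) ^ n * \<phi> z z) / (4 powr \<beta>) ^ Suc n"
    by (intro divide_right_mono mult_left_mono phi_dbl phi_nonneg) simp
  \<comment> \<open>Enlarging the growth factor to \<open>4 powr \<beta> * L\<close> matches the
    divisor, so the ratio becomes exactly \<open>L\<close> and the sum of the increments has the
    constant of the second bound.\<close>
  also have "\<dots> \<le> \<phi> x 0 * ((4 powr \<beta> * L) ^ n * \<phi> z z) / (4 powr \<beta>) ^ Suc n"
    using L_nonneg Y.beta_pos
    by (intro divide_right_mono mult_left_mono mult_right_mono power_mono phi_nonneg
        powr_mono2) auto
  also have "\<dots> = \<phi> x 0 * \<phi> z z / 4 powr \<beta> * L ^ n"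
    by (simp add: power_mult_distrib field_simps)
  finally show ?thesis .
qed

text \<open>Since \<open>F x z\<close> equals \<open>F x (dbl n z)\<close> divided by
  \<open>4 ^ n\<close>, the error is the first bound at \<open>dbl n z\<close> divided by
  \<open>(4 powr \<beta>) ^ n\<close>. There \<open>\<phi> x x\<close> stays fixed and
  \<open>\<phi> (dbl n z) 0\<close> grows like \<open>(2 powr \<beta> * L) ^ n\<close>, which leaves
  the ratio \<open>L / 2 powr \<beta> < 1\<close>. The iterates depend on \<open>f\<close> alone, so
  they identify \<open>F\<close>.\<close>

lemma right_iterates_tendsto:
  assumes F: "additive_quadratic scaleY F"
    and bound: "\<And>x z. normY (f x z - F x z) \<le> c * \<phi> x x * \<phi> z 0"
    and c: "0 \<le> c"
  shows "(\<lambda>n. normY (scaleY ((1/4) ^ n) (f x (dbl n z)) - F x z)) \<longlonglongrightarrow> 0"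
proof -
  have F_dbl: "F x (dbl n z) = scaleY (4 ^ n) (F x z)" for n
  proof (induction n)
    case (Suc n)
    then show ?case
      by (simp add: dbl_Suc additive_quadratic_double[OF Y.vector_space_axioms F]
          del: power_Suc) simp
  qed simp
  have "normY (scaleY ((1/4) ^ n) (f x (dbl n z)) - F x z)
      \<le> c * \<phi> x x * \<phi> z 0 * (L / 2 powr \<beta>) ^ n" for n
  proof -
    have "F x z = scaleY ((1/4) ^ n) (F x (dbl n z))"
      by (simp add: F_dbl flip: power_mult_distrib)
    then have "normY (scaleY ((1/4) ^ n) (f x (dbl n z)) - F x z)
        = normY (f x (dbl n z) - F x (dbl n z)) / (4 powr \<beta>) ^ n"
      by (metis Y.scale_right_diff_distrib normY_quarter_power)
    \<comment> \<open>Writing 0 as \<open>dbl n 0\<close> brings the second factor into the form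
      required by \<open>phi_dbl\<close>.\<close>
    also have "\<dots> \<le> c * \<phi> x x * \<phi> (dbl n z) (dbl n 0) / (4 powr \<beta>) ^ n"
      using bound[of x "dbl n z"] by (intro divide_right_mono) auto
    also have "\<dots> \<le> c * \<phi> x x * ((2 powr \<beta> * L) ^ n * \<phi> z 0) / (4 powr \<beta>) ^ n"
      using c by (intro divide_right_mono mult_left_mono phi_dbl mult_nonneg_nonneg phi_nonneg) auto
    also have "\<dots> = c * \<phi> x x * \<phi> z 0 * (L / 2 powr \<beta>) ^ n"
      by (simp add: four_powr power_mult_distrib field_simps)
    finally show ?thesis .
  qed
  then have upper: "\<forall>\<^sub>F n in sequentially. normY (scaleY ((1/4) ^ n) (f x (dbl n z)) - F x z)
      \<le> c * \<phi> x x * \<phi> z 0 * (L / 2 powr \<beta>) ^ n"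
    by simp
  have "(\<lambda>n. c * \<phi> x x * \<phi> z 0 * (L / 2 powr \<beta>) ^ n) \<longlonglongrightarrow> 0"
    using L_nonneg L_less_1 two_powr_gt_1
    by (intro tendsto_mult_right_zero LIMSEQ_realpow_zero) (auto simp: field_simps)
  from tendsto_sandwich[OF _ upper tendsto_const this] show ?thesis
    by (simp add: Y.nrm_nonneg)
qed

section \<open>The limit mapping and its bounds\<close>

lemma left_iterates_limit:
  obtains F where "\<And>x z. (\<lambda>n. normY (scaleY ((1/2) ^ n) (f (dbl n x) z) - F x z)) \<longlonglongrightarrow> 0"
proof -
  have "\<forall>x z. \<exists>l. (\<lambda>n. normY (scaleY ((1/2) ^ n) (f (dbl n x) z) - l)) \<longlonglongrightarrow> 0"
    using Y.geometric_limit[OF L_nonneg L_less_1 left_iterates_step] by blast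
  then show ?thesis using that by metis
qed

text \<open>The defect \<open>E n\<close> of the iterates is a rescaled defect of \<open>f\<close>
  with only \<open>x\<close> and \<open>y\<close> dilated, so it decays like \<open>L ^ n\<close>.
  It also tends to the defect of \<open>F\<close>, which is therefore 0.\<close>

lemma left_limit_additive_quadratic:
  assumes lim: "\<And>x z. (\<lambda>n. normY (scaleY ((1/2) ^ n) (f (dbl n x) z) - F x z)) \<longlonglongrightarrow> 0"
  shows "additive_quadratic scaleY F"
  unfolding additive_quadratic_def
proof (intro allI)
  fix x y z w
  define g where "g n x z = scaleY ((1/2) ^ n) (f (dbl n x) z)" for n x z
  define E where "E n = g n (x + y) (z + w) + g n (x - y) (z - w)
    - scaleY 2 (g n x z) - scaleY 2 (g n x w)" for n
  have "(\<lambda>n. normY (g n x z - F x z)) \<longlonglongrightarrow> 0" for x z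
    using lim unfolding g_def .
  then have "(\<lambda>n. normY (E n - (F (x + y) (z + w) + F (x - y) (z - w)
      - scaleY 2 (F x z) - scaleY 2 (F x w)))) \<longlonglongrightarrow> 0"
    unfolding E_def by (intro Y.nrm_limit_add Y.nrm_limit_diff Y.nrm_limit_scale)
  moreover have "(\<lambda>n. normY (E n - 0)) \<longlonglongrightarrow> 0"
  proof (rule tendsto_sandwich[OF _ _ tendsto_const])
    have "normY (E n) \<le> \<phi> x y * \<phi> z w * L ^ n" for n
    proof -
      have "E n = scaleY ((1/2) ^ n)
          (f (dbl n x + dbl n y) (z + w) + f (dbl n x - dbl n y) (z - w)
            - scaleY 2 (f (dbl n x) z) - scaleY 2 (f (dbl n x) w))"
        unfolding E_def g_def
        by (simp add: X.scale_right_distrib X.scale_right_diff_distrib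
            Y.scale_right_distrib Y.scale_right_diff_distrib mult.commute)
      then have "normY (E n) \<le> \<phi> (dbl n x) (dbl n y) * \<phi> z w / (2 powr \<beta>) ^ n"
        by (simp only: normY_half_power) (intro divide_right_mono approx, simp)
      also have "\<dots> \<le> ((2 powr \<beta> * L) ^ n * \<phi> x y) * \<phi> z w / (2 powr \<beta>) ^ n"
        by (intro divide_right_mono mult_right_mono phi_dbl phi_nonneg) simp
      also have "\<dots> = \<phi> x y * \<phi> z w * L ^ n"
        by (simp add: power_mult_distrib field_simps)
      finally show ?thesis .
    qed
    then show "\<forall>\<^sub>F n in sequentially. normY (E n - 0) \<le> \<phi> x y * \<phi> z w * L ^ n" by simp
    show "(\<lambda>n. \<phi> x y * \<phi> z w * L ^ n) \<longlonglongrightarrow> 0"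
      using L_nonneg L_less_1 by (intro tendsto_mult_right_zero LIMSEQ_realpow_zero) auto
  qed (simp add: Y.nrm_nonneg)
  ultimately show "F (x + y) (z + w) + F (x - y) (z - w) - scaleY 2 (F x z) - scaleY 2 (F x w) = 0"
    by (rule Y.nrm_limit_unique)
qed

text \<open>The iterate of index 0 is \<open>f x z\<close>, so the geometric bound from
  \<open>m = 0\<close> holds along the sequence and passes to the limit.\<close>

lemma left_limit_bound:
  assumes "(\<lambda>n. normY (scaleY ((1/2) ^ n) (f (dbl n x) z) - l)) \<longlonglongrightarrow> 0"
  shows "normY (f x z - l) \<le> 1 / (2 powr \<beta> * (1 - L)) * \<phi> x x * \<phi> z 0"
proof (rule Y.nrm_limit_le[OF assms])
  show "normY (f x z - scaleY ((1/2) ^ n) (f (dbl n x) z))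
      \<le> 1 / (2 powr \<beta> * (1 - L)) * \<phi> x x * \<phi> z 0" for n
    using Y.nrm_diff_geometric_bound[OF L_nonneg L_less_1 left_iterates_step[of _ x z], of 0 n]
    by (simp add: Y.nrm_diff_commute)
qed

lemma right_limit_bound:
  assumes "(\<lambda>n. normY (scaleY ((1/4) ^ n) (f x (dbl n z)) - l)) \<longlonglongrightarrow> 0"
  shows "normY (f x z - l) \<le> 1 / (4 powr \<beta> * (1 - L)) * \<phi> x 0 * \<phi> z z"
proof (rule Y.nrm_limit_le[OF assms])
  show "normY (f x z - scaleY ((1/4) ^ n) (f x (dbl n z)))
      \<le> 1 / (4 powr \<beta> * (1 - L)) * \<phi> x 0 * \<phi> z z" for n
    using Y.nrm_diff_geometric_bound[OF L_nonneg L_less_1 right_iterates_step[of _ x z], of 0 n]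
    by (simp add: Y.nrm_diff_commute)
qed

theorem stability:
  "\<exists>!F. additive_quadratic scaleY F \<and>
     (\<forall>x z. normY (f x z - F x z)
        \<le> min (1 / (2 powr \<beta> * (1 - L)) * \<phi> x x * \<phi> z 0)
              (1 / (4 powr \<beta> * (1 - L)) * \<phi> x 0 * \<phi> z z))"
proof -
  let ?c = "1 / (2 powr \<beta> * (1 - L))"
  have c: "0 \<le> ?c" using L_less_1 by simp
  obtain F where lim: "\<And>x z. (\<lambda>n. normY (scaleY ((1/2) ^ n) (f (dbl n x) z) - F x z)) \<longlonglongrightarrow> 0"
    using left_iterates_limit by blast
  have F: "additive_quadratic scaleY F"
    using lim by (rule left_limit_additive_quadratic)
  show ?thesis
  proof (rule ex1I[of _ F])
    show "additive_quadratic scaleY F \<and>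
       (\<forall>x z. normY (f x z - F x z)
          \<le> min (?c * \<phi> x x * \<phi> z 0) (1 / (4 powr \<beta> * (1 - L)) * \<phi> x 0 * \<phi> z z))"
      \<comment> \<open>The first bound makes \<open>F x z\<close> the limit of the right iterates
        as well, and that limit satisfies the second bound.\<close>
      using F left_limit_bound[OF lim]
        right_limit_bound[OF right_iterates_tendsto[OF F left_limit_bound[OF lim] c]]
      by simp
  next
    fix G
    assume G: "additive_quadratic scaleY G \<and>
       (\<forall>x z. normY (f x z - G x z)
          \<le> min (?c * \<phi> x x * \<phi> z 0) (1 / (4 powr \<beta> * (1 - L)) * \<phi> x 0 * \<phi> z z))"
    then have G_bound: "normY (f x z - G x z) \<le> ?c * \<phi> x x * \<phi> z 0" for x z
      by simp
    \<comment> \<open>Both values are limits of the same right iterates of \<open>f\<close>.\<close>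
    have "G x z = F x z" for x z
      using right_iterates_tendsto[OF conjunct1[OF G] G_bound c]
        right_iterates_tendsto[OF F left_limit_bound[OF lim] c]
      by (rule Y.nrm_limit_unique)
    then show "G = F" by (intro ext)
  qed
qed

end

section \<open>Reduction to nonnegative \<open>L\<close>\<close>

theorem theorem6:
  fixes scaleX :: "complex \<Rightarrow> 'a::ab_group_add \<Rightarrow> 'a" and normX :: "'a \<Rightarrow> real"
    and scaleY :: "complex \<Rightarrow> 'b::ab_group_add \<Rightarrow> 'b" and normY :: "'b \<Rightarrow> real"
    and \<beta> L :: real
    and \<phi> :: "'a \<Rightarrow> 'a \<Rightarrow> real"
    and f :: "'a \<Rightarrow> 'a \<Rightarrow> 'b"
  assumes "\<beta> > 0"
    and "homogeneous_F_space scaleX normX \<beta>"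
    and "homogeneous_F_space scaleY normY \<beta>"
    and "\<And>x y. \<phi> x y \<ge> 0"
    and "L < 1"
    and "\<And>x y. \<phi> x y \<le> 2 powr \<beta> * L * \<phi> (scaleX (1/2) x) (scaleX (1/2) y)"
    and "\<And>x y. 2 powr \<beta> * L * \<phi> (scaleX (1/2) x) (scaleX (1/2) y)
               \<le> 4 powr \<beta> * L * \<phi> (scaleX (1/2) x) (scaleX (1/2) y)"
    and "\<And>x y z w. normY (f (x + y) (z + w) + f (x - y) (z - w)
                            - scaleY 2 (f x z) - scaleY 2 (f x w)) \<le> \<phi> x y * \<phi> z w"
    and "\<And>x. f x 0 = 0"
    and "\<And>z. f 0 z = 0"
  shows "\<exists>!F :: 'a \<Rightarrow> 'a \<Rightarrow> 'b. additive_quadratic scaleY F \<and>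
           (\<forall>x z. normY (f x z - F x z)
              \<le> min (1 / (2 powr \<beta> * (1 - L)) * \<phi> x x * \<phi> z 0)
                    (1 / (4 powr \<beta> * (1 - L)) * \<phi> x 0 * \<phi> z z))"
proof -
  note half = assms(6)
  interpret X: homogeneous_F_space scaleX normX \<beta> by fact
  interpret Y: homogeneous_F_space scaleY normY \<beta> by fact
  show ?thesis
  proof (cases "0 \<le> L")
    case True
    interpret approx_additive_quadratic scaleX scaleY normY \<beta> L \<phi> f
      by unfold_locales (use assms True in auto)
    show ?thesis by (rule stability)
  next
    case False
    \<comment> \<open>For negative \<open>L\<close> the contraction inequality bounds the
      nonnegative \<open>\<phi>\<close> by a nonpositive quantity.\<close>
    have zero: "\<phi> x y = 0" for x y
    proof -
      have "2 powr \<beta> * L * \<phi> (scaleX (1/2) x) (scaleX (1/2) y) \<le> 0"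
        using False assms(4) by (intro mult_nonpos_nonneg mult_nonneg_nonpos) auto
      then show ?thesis using half[of x y] assms(4)[of x y] by linarith
    qed
    \<comment> \<open>With \<open>\<phi>\<close> identically 0 the contraction inequality also holds
      for the constant 0, and both sides of the minimum are 0 for either constant, so the two
      conclusions coincide.\<close>
    interpret approx_additive_quadratic scaleX scaleY normY \<beta> 0 \<phi> f
      by unfold_locales (use assms(8-10) zero in auto)
    show ?thesis using stability by (simp add: zero)
  qed
qed

end
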